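(* Let $\mathcal E$ and $\overline{\mathcal E}$ be two ODEs of the form $y'=(p(x)y+q(x))^5+r(x)y^2+s(x)y+t(x)$ with $p,r\neq0$. Then $\mathcal E$ and $\overline{\mathcal E}$ are $G$-equivalent in the neighborhood of a point $x$ if and only if $$J_0^{\mathcal E}=J_0^{\overline{\mathcal E}},\quad J_1^{\mathcal E}=J_1^{\overline{\mathcal E}},\quad (\nabla J_0)^{\mathcal E}=(\nabla J_0)^{\overline{\mathcal E}},\quad (\nabla J_1)^{\mathcal E}=(\nabla J_1)^{\overline{\mathcal E}}$$ and at least one of the functions $J_0^{\mathcal E}$, $J_1^{\mathcal E}$, $(\nabla J_0)^{\mathcal E}$, $(\nabla J_1)^{\mathcal E}$ has non-zero derivative at $x$.
   Context: All coefficients are $C^\infty$. $G$ is the pseudogroup of local (invertible) point transformations $x\mapsto f(x)$, $y\mapsto g(x)\cdot y+h(x)$, with $f,g,h$ smooth ($f'\ne 0$, $g\neq0$). Two equations are $G$-equivalent in the neighborhood of $x$ if some transformation in $G$, defined over a neighborhood of $x$, transforms one into the other. Put $$L_2=-p'q+q'p+q^2r-pqs+tp^2,\qquad L_3=5p'r+3prs-6qr^2-pr',$$ $$J_0=\frac{L_2\cdot p^{4/3}}{r^{5/3}},\qquad J_1=\frac{L_3\cdot p^{2/3}}{r^{7/3}},\qquad \nabla=\frac{p^{5/3}}{r^{4/3}}\frac{D}{Dx},$$ where $\frac{D}{Dx}$ is the total derivative with respect to $x$ and fractional powers are taken with real cube roots. A superscript $\mathcal E$ means evaluation at the coefficients $p,q,r,s,t$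 of $\mathcal E$, giving functions of $x$.
   Formalization: The non-zero derivative condition is a hypothesis on E at x, not part of the equivalence (it fails for E equivalent to itself with constant invariants), and the four equalities hold after one common local change of the variable x, since equivalences may move x. *)

theory Defs
  imports "HOL-Analysis.Analysis"
begin

text \<open>
  \<open>deriv f x\<close> at a point of an open set depends only on \<open>f\<close> near that point, so for open \<open>U\<close> this is
  \<open>f \<in> C\<^sup>\<infinity>(U)\<close>; the values of \<open>f\<close> outside \<open>U\<close> are irrelevant.
\<close>

definition smooth_on :: "real set \<Rightarrow> (real \<Rightarrow> real) \<Rightarrow> bool" where
  "smooth_on U f \<longleftrightarrow> (\<forall>n. \<forall>x\<in>U. (deriv ^^ n) f differentiable (at x))"


section \<open>The equations\<close>

text \<open>
  The equation \<open>y' = (p(x) y + q(x))\<^sup>5 + r(x) y\<^sup>2 + s(x) y + t(x)\<close>, over the set \<open>dom\<close> of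
  values of \<open>x\<close>.
\<close>

record ode =
  dom :: "real set"
  p :: "real \<Rightarrow> real"
  q :: "real \<Rightarrow> real"
  r :: "real \<Rightarrow> real"
  s :: "real \<Rightarrow> real"
  t :: "real \<Rightarrow> real"

definition admissible :: "ode \<Rightarrow> bool" where
  "admissible E \<longleftrightarrow> open (dom E) \<and>
     smooth_on (dom E) (p E) \<and> smooth_on (dom E) (q E) \<and> smooth_on (dom E) (r E) \<and>
     smooth_on (dom E) (s E) \<and> smooth_on (dom E) (t E) \<and>
     (\<forall>x\<in>dom E. p E x \<noteq> 0 \<and> r E x \<noteq> 0)"

definition rhs :: "ode \<Rightarrow> real \<Rightarrow> real \<Rightarrow> real" where
  "rhs E x y = (p E x * y + q E x) ^ 5 + r E x * y\<^sup>2 + s E x * y + t E x"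

text \<open>
  The restriction of the equation to \<open>U\<close>, as a surface in the space of 1-jets with coordinates
  \<open>(x, y, y')\<close>.
\<close>

definition ode_surface :: "ode \<Rightarrow> real set \<Rightarrow> (real \<times> real \<times> real) set" where
  "ode_surface E U = {(x, y, y1). x \<in> U \<and> y1 = rhs E x y}"


section \<open>The pseudogroup of point transformations\<close>

definition local_diffeo :: "real set \<Rightarrow> (real \<Rightarrow> real) \<Rightarrow> bool" where
  "local_diffeo U f \<longleftrightarrow>
     open U \<and> smooth_on U f \<and> (\<forall>x\<in>U. deriv f x \<noteq> 0) \<and> inj_on f U"

text \<open>The transformation \<open>x \<mapsto> f(x)\<close>, \<open>y \<mapsto> g(x) y + h(x)\<close> over \<open>U\<close>.\<close>

definition point_transformation ::
  "real set \<Rightarrow> (real \<Rightarrow> real) \<Rightarrow> (real \<Rightarrow> real) \<Rightarrow> (real \<Rightarrow> real) \<Rightarrow> bool" where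
  "point_transformation U f g h \<longleftrightarrow>
     local_diffeo U f \<and> smooth_on U g \<and> smooth_on U h \<and> (\<forall>x\<in>U. g x \<noteq> 0)"

text \<open>The prolongation to 1-jets: \<open>y'\<close> goes to \<open>D(g y + h) / D f\<close>.\<close>

definition prolong ::
  "(real \<Rightarrow> real) \<Rightarrow> (real \<Rightarrow> real) \<Rightarrow> (real \<Rightarrow> real) \<Rightarrow>
     real \<times> real \<times> real \<Rightarrow> real \<times> real \<times> real" where
  "prolong f g h = (\<lambda>(x, y, y1).
     (f x, g x * y + h x, (deriv g x * y + g x * y1 + deriv h x) / deriv f x))"

text \<open>
  The 1-jet of a function is mapped to the 1-jet of the function with the transformed graph, so
  solutions of an equation are mapped to solutions of the transformed equation.
\<close>

lemma prolong_jet: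
  assumes T: "point_transformation U f g h" and u: "u \<in> U"
    and Y: "(Y has_real_derivative y1) (at u)"
    and Z: "(Z has_real_derivative z1) (at (f u))"
    and graph: "\<And>x. x \<in> U \<Longrightarrow> Z (f x) = g x * Y x + h x"
  shows "prolong f g h (u, Y u, y1) = (f u, Z (f u), z1)"
proof -
  have diff: "(k has_real_derivative deriv k u) (at u)" if "smooth_on U k" for k
  proof -
    have "k differentiable (at u)"
      using that u unfolding smooth_on_def by (metis funpow_0)
    then show ?thesis
      by (metis DERIV_imp_deriv real_differentiable_def)
  qed
  have df: "(f has_real_derivative deriv f u) (at u)"
    and dg: "(g has_real_derivative deriv g u) (at u)"
    and dh: "(h has_real_derivative deriv h u) (at u)"
    and f0: "deriv f u \<noteq> 0" and U: "open U"
    using T u diff by (auto simp: point_transformation_def local_diffeo_def)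
  have "((\<lambda>x. Z (f x)) has_real_derivative z1 * deriv f u) (at u)"
    by (rule DERIV_chain2[OF Z df])
  then have "((\<lambda>x. g x * Y x + h x) has_real_derivative z1 * deriv f u) (at u)"
    by (rule has_field_derivative_transform_within_open[OF _ U u]) (rule graph)
  moreover have "((\<lambda>x. g x * Y x + h x) has_real_derivative
      (deriv g u * Y u + y1 * g u) + deriv h u) (at u)"
    by (intro DERIV_add DERIV_mult dg Y dh)
  ultimately have "z1 * deriv f u = (deriv g u * Y u + y1 * g u) + deriv h u"
    by (rule DERIV_unique)
  then show ?thesis
    using f0 graph[OF u] by (simp add: prolong_def field_simps)
qed

text \<open>The transformation need not fix \<open>x\<close>; it carries a neighborhood of \<open>x\<close> to one of \<open>f(x)\<close>.\<close>

definition G_equivalent_near :: "ode \<Rightarrow> ode \<Rightarrow> real \<Rightarrow> bool" where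
  "G_equivalent_near E F x \<longleftrightarrow>
     (\<exists>U f g h. x \<in> U \<and> U \<subseteq> dom E \<and> point_transformation U f g h \<and> f ` U \<subseteq> dom F \<and>
        prolong f g h ` ode_surface E U = ode_surface F (f ` U))"


section \<open>The differential invariants\<close>

text \<open>
  All expressions below are already evaluated at the coefficients of an equation, so that the
  total derivative becomes the ordinary derivative. \<open>root 3\<close> is the real cube root, odd on the
  negative half-line.
\<close>

definition L2 :: "ode \<Rightarrow> real \<Rightarrow> real" where
  "L2 E x = - deriv (p E) x * q E x + deriv (q E) x * p E x + (q E x)\<^sup>2 * r E x
     - p E x * q E x * s E x + t E x * (p E x)\<^sup>2"

definition L3 :: "ode \<Rightarrow> real \<Rightarrow> real" where
  "L3 E x = 5 * deriv (p E) x * r E x + 3 * p E x * r E x * s E x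
     - 6 * q E x * (r E x)\<^sup>2 - p E x * deriv (r E) x"

definition J0 :: "ode \<Rightarrow> real \<Rightarrow> real" where
  "J0 E x = L2 E x * root 3 (p E x) ^ 4 / root 3 (r E x) ^ 5"

definition J1 :: "ode \<Rightarrow> real \<Rightarrow> real" where
  "J1 E x = L3 E x * root 3 (p E x) ^ 2 / root 3 (r E x) ^ 7"

definition nabla :: "ode \<Rightarrow> (real \<Rightarrow> real) \<Rightarrow> real \<Rightarrow> real" where
  "nabla E J x = root 3 (p E x) ^ 5 / root 3 (r E x) ^ 4 * deriv J x"

end

theory Submission
  imports Defs
begin

text \<open>
  Every equation has a canonical form. Its right-hand side has a center: the curve
  \<open>y = - q/p\<close>, along which the fifth power vanishes. Measure \<open>y\<close> from the center in units
  \<open>p\<^bsup>-5/3\<^esup> r\<^bsup>1/3\<^esup>\<close> and \<open>x\<close> by the form \<open>r\<^bsup>4/3\<^esup> p\<^bsup>-5/3\<^esup> dx\<close>: the coefficients of the fifth and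
  the second power become \<open>1\<close>, and the equation becomes \<open>y' = y\<^sup>5 + y\<^sup>2 + (J\<^sub>1/3) y + J\<^sub>0\<close>, while
  \<open>nabla\<close> is the derivative with respect to the new \<open>x\<close>. Nothing but a translation of the new
  \<open>x\<close> is left free.

  Hence a change of variable \<open>f\<close> is the first component of an equivalence exactly if it carries
  one scaling form \<open>x_scale dx\<close> to the other and matches \<open>J\<^sub>0\<close> and \<open>J\<^sub>1\<close>; then \<open>g\<close> and \<open>h\<close> are
  forced. This is \<open>transforms_iff_invariants\<close>. It is obtained without passing to the canonical
  form, by comparing the coefficients of two polynomials in \<open>y - c\<close>, where \<open>c\<close> is the center
  (\<open>transformed_iff_coeffs\<close>). The degrees 5 and 2 fix the two scales, and the degrees 1 and 0
  give the equality of \<open>J\<^sub>1\<close> and of \<open>J\<^sub>0\<close>.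

  It remains to trade the condition on the scaling forms for the equality of \<open>nabla J\<^sub>0\<close> and
  \<open>nabla J\<^sub>1\<close>. If \<open>f\<close> matches \<open>J\<close>, the chain rule gives
  \<open>nabla J \<cdot> x_scale = (nabla J \<circ> f) \<cdot> f' \<cdot> (x_scale \<circ> f)\<close> (\<open>nabla_naturality\<close>). So if the scaling
  forms match, then so do the functions \<open>nabla J\<close>. Conversely, if the functions \<open>nabla J\<close> match,
  then the scaling forms match wherever \<open>nabla J\<close> is non-zero. At the given point, \<open>nabla J\<^sub>0\<close> and
  \<open>nabla J\<^sub>1\<close> may both vanish, but by the hypothesis on derivatives one of them is then non-zero
  nearby off the point, and continuity supplies the point itself.
\<close>


section \<open>Calculus of smooth functions\<close>

text \<open>
  Smoothness is not inductive as it stands: the derivative of \<open>f g\<close> involves \<open>f\<close> and \<open>g\<close> again, so a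
  closure proof needs an order of differentiability to descend on.
\<close>

definition differentiable_upto :: "nat \<Rightarrow> real set \<Rightarrow> (real \<Rightarrow> real) \<Rightarrow> bool" where
  "differentiable_upto n U f \<longleftrightarrow> (\<forall>m<n. \<forall>x\<in>U. (deriv ^^ m) f differentiable (at x))"

lemma smooth_on_iff_differentiable_upto:
  "smooth_on U f \<longleftrightarrow> (\<forall>n. differentiable_upto n U f)"
  unfolding smooth_on_def differentiable_upto_def by blast

lemma differentiable_upto_0 [simp]: "differentiable_upto 0 U f"
  by (simp add: differentiable_upto_def)

lemma differentiable_upto_Suc:
  "differentiable_upto (Suc n) U f \<longleftrightarrow>
     (\<forall>x\<in>U. f differentiable (at x)) \<and> differentiable_upto n U (deriv f)"
  unfolding differentiable_upto_def All_less_Suc2 funpow_Suc_right by simp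

lemma differentiable_upto_Suc_imp:
  "differentiable_upto (Suc n) U f \<Longrightarrow> differentiable_upto n U f"
  by (simp add: differentiable_upto_def)

lemma differentiable_upto_Suc_DERIV:
  "differentiable_upto (Suc n) U f \<Longrightarrow> x \<in> U \<Longrightarrow> (f has_real_derivative deriv f x) (at x)"
  unfolding differentiable_upto_Suc by (metis DERIV_imp_deriv real_differentiable_def)

lemma differentiable_upto_cong:
  assumes "open U" "\<And>x. x \<in> U \<Longrightarrow> f x = g x" "differentiable_upto n U f"
  shows "differentiable_upto n U g"
  using assms(2,3)
proof (induction n arbitrary: f g)
  case (Suc n)
  have D: "(g has_real_derivative deriv f x) (at x)" if "x \<in> U" for x
    using has_field_derivative_transform_within_open
      [OF differentiable_upto_Suc_DERIV[OF Suc.prems(2) that] \<open>open U\<close> that, of g] Suc.prems(1)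
    by blast
  have "differentiable_upto n U (deriv g)"
  proof (rule Suc.IH)
    show "deriv f x = deriv g x" if "x \<in> U" for x
      using DERIV_imp_deriv[OF D[OF that]] by simp
    show "differentiable_upto n U (deriv f)"
      using Suc.prems(2) by (simp add: differentiable_upto_Suc)
  qed
  then show ?case
    using D by (auto simp: differentiable_upto_Suc real_differentiable_def)
qed simp

text \<open>
  All closure properties below go by induction on the order with this rule: the derivative of a
  sum, product, composite, reciprocal or root is an expression in these operations applied to
  functions whose order is already known.
\<close>

lemma differentiable_upto_SucI:
  assumes U: "open U" and D: "\<And>x. x \<in> U \<Longrightarrow> (f has_real_derivative f' x) (at x)"
    and n: "differentiable_upto n U f'"
  shows "differentiable_upto (Suc n) U f"
proof -
  have "differentiable_upto n U (deriv f)"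
    by (rule differentiable_upto_cong[OF U _ n]) (metis D DERIV_imp_deriv)
  with D show ?thesis
    by (auto simp: differentiable_upto_Suc real_differentiable_def)
qed

lemma differentiable_upto_const:
  assumes "open U"
  shows "differentiable_upto n U (\<lambda>x. c)"
proof (induction n arbitrary: c)
  case (Suc n)
  then show ?case
    by (intro differentiable_upto_SucI[OF assms, where f' = "\<lambda>x. 0"]) auto
qed simp

lemma differentiable_upto_add:
  assumes U: "open U" and "differentiable_upto n U f" "differentiable_upto n U g"
  shows "differentiable_upto n U (\<lambda>x. f x + g x)"
  using assms(2,3)
proof (induction n arbitrary: f g)
  case (Suc n)
  show ?case
    by (rule differentiable_upto_SucI[OF U, where f' = "\<lambda>x. deriv f x + deriv g x"])
      (use Suc in \<open>auto intro!: DERIV_add differentiable_upto_Suc_DERIV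
         simp: differentiable_upto_Suc\<close>)
qed simp

lemma differentiable_upto_mult:
  assumes U: "open U" and "differentiable_upto n U f" "differentiable_upto n U g"
  shows "differentiable_upto n U (\<lambda>x. f x * g x)"
  using assms(2,3)
proof (induction n arbitrary: f g)
  case (Suc n)
  note low = Suc.prems[THEN differentiable_upto_Suc_imp]
  have n: "differentiable_upto n U (deriv f)" "differentiable_upto n U (deriv g)"
    using Suc.prems by (simp_all add: differentiable_upto_Suc)
  show ?case
  proof (rule differentiable_upto_SucI[OF U])
    show "((\<lambda>x. f x * g x) has_real_derivative deriv f x * g x + deriv g x * f x) (at x)"
      if "x \<in> U" for x
      using Suc.prems that by (intro DERIV_mult differentiable_upto_Suc_DERIV)
    show "differentiable_upto n U (\<lambda>x. deriv f x * g x + deriv g x * f x)"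
      by (intro differentiable_upto_add[OF U] Suc.IH low n)
  qed
qed simp

lemma differentiable_upto_compose:
  assumes U: "open U" and "differentiable_upto n V f" "differentiable_upto n U g" "g ` U \<subseteq> V"
  shows "differentiable_upto n U (\<lambda>x. f (g x))"
  using assms(2,3)
proof (induction n arbitrary: f)
  case (Suc n)
  have n: "differentiable_upto n V (deriv f)" "differentiable_upto n U (deriv g)"
    using Suc.prems by (simp_all add: differentiable_upto_Suc)
  show ?case
  proof (rule differentiable_upto_SucI[OF U])
    show "((\<lambda>x. f (g x)) has_real_derivative deriv f (g x) * deriv g x) (at x)" if "x \<in> U" for x
      using Suc.prems that \<open>g ` U \<subseteq> V\<close>
      by (intro DERIV_chain2 differentiable_upto_Suc_DERIV) auto
    show "differentiable_upto n U (\<lambda>x. deriv f (g x) * deriv g x)"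
      by (rule differentiable_upto_mult[OF U Suc.IH[OF n(1) differentiable_upto_Suc_imp] n(2)])
        (rule Suc.prems)
  qed
qed simp

lemma differentiable_upto_inverse: "differentiable_upto n (- {0}) inverse"
proof (induction n)
  case (Suc n)
  show ?case
  proof (rule differentiable_upto_SucI)
    show "(inverse has_real_derivative - 1 * (inverse x * inverse x)) (at x)" if "x \<in> - {0}" for x :: real
      using that by (auto intro!: derivative_eq_intros simp: field_simps)
    show "differentiable_upto n (- {0}) (\<lambda>x. - 1 * (inverse x * inverse x))"
      by (intro differentiable_upto_mult differentiable_upto_const Suc.IH open_Compl closed_singleton)
  qed (intro open_Compl closed_singleton)
qed simp

lemma differentiable_upto_cube_root: "differentiable_upto n (- {0}) (root 3)"
proof (induction n)
  case (Suc n)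
  show ?case
  proof (rule differentiable_upto_SucI)
    show "(root 3 has_real_derivative inverse (3 * (root 3 x * root 3 x))) (at x)"
      if "x \<in> - {0}" for x :: real
      using DERIV_odd_real_root[of 3 x] that by (simp add: power2_eq_square)
    show "differentiable_upto n (- {0}) (\<lambda>x. inverse (3 * (root 3 x * root 3 x)))"
      by (rule differentiable_upto_compose[OF _ differentiable_upto_inverse])
        (auto intro!: differentiable_upto_mult differentiable_upto_const Suc.IH)
  qed (intro open_Compl closed_singleton)
qed simp

lemma smooth_on_DERIV:
  "smooth_on U f \<Longrightarrow> x \<in> U \<Longrightarrow> (f has_real_derivative deriv f x) (at x)"
  using differentiable_upto_Suc_DERIV smooth_on_iff_differentiable_upto by blast

lemma smooth_on_isCont: "smooth_on U f \<Longrightarrow> x \<in> U \<Longrightarrow> isCont f x"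
  using smooth_on_DERIV DERIV_isCont by blast

lemma smooth_on_deriv: "smooth_on U f \<Longrightarrow> smooth_on U (deriv f)"
  unfolding smooth_on_iff_differentiable_upto using differentiable_upto_Suc by blast

lemma smooth_on_subset: "smooth_on U f \<Longrightarrow> V \<subseteq> U \<Longrightarrow> smooth_on V f"
  unfolding smooth_on_def by blast

lemma smooth_on_const: "open U \<Longrightarrow> smooth_on U (\<lambda>x. c)"
  by (simp add: smooth_on_iff_differentiable_upto differentiable_upto_const)

lemma smooth_on_add: "open U \<Longrightarrow> smooth_on U f \<Longrightarrow> smooth_on U g \<Longrightarrow> smooth_on U (\<lambda>x. f x + g x)"
  by (simp add: smooth_on_iff_differentiable_upto differentiable_upto_add)

lemma smooth_on_mult: "open U \<Longrightarrow> smooth_on U f \<Longrightarrow> smooth_on U g \<Longrightarrow> smooth_on U (\<lambda>x. f x * g x)"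
  by (simp add: smooth_on_iff_differentiable_upto differentiable_upto_mult)

lemma smooth_on_compose:
  "open U \<Longrightarrow> smooth_on V f \<Longrightarrow> smooth_on U g \<Longrightarrow> g ` U \<subseteq> V \<Longrightarrow> smooth_on U (\<lambda>x. f (g x))"
  unfolding smooth_on_iff_differentiable_upto using differentiable_upto_compose by blast

lemma smooth_on_minus: "open U \<Longrightarrow> smooth_on U f \<Longrightarrow> smooth_on U (\<lambda>x. - f x)"
  using smooth_on_mult[OF _ smooth_on_const[of U "- 1"], of f] by simp

lemma smooth_on_diff: "open U \<Longrightarrow> smooth_on U f \<Longrightarrow> smooth_on U g \<Longrightarrow> smooth_on U (\<lambda>x. f x - g x)"
  using smooth_on_add[of U f "\<lambda>x. - g x"] smooth_on_minus[of U g] by simp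

lemma smooth_on_divide:
  assumes "open U" "smooth_on U f" "smooth_on U g" "\<And>x. x \<in> U \<Longrightarrow> g x \<noteq> 0"
  shows "smooth_on U (\<lambda>x. f x / g x)"
proof -
  have "smooth_on U (\<lambda>x. inverse (g x))"
    by (rule smooth_on_compose[where V = "- {0}" and f = inverse])
      (use assms differentiable_upto_inverse in
        \<open>auto simp: smooth_on_iff_differentiable_upto\<close>)
  then show ?thesis
    unfolding divide_inverse by (intro smooth_on_mult assms)
qed

lemma smooth_on_power: "open U \<Longrightarrow> smooth_on U f \<Longrightarrow> smooth_on U (\<lambda>x. f x ^ n)"
  by (induction n) (auto intro: smooth_on_const smooth_on_mult)

lemma smooth_on_cube_root:
  assumes "open U" "smooth_on U f" "\<And>x. x \<in> U \<Longrightarrow> f x \<noteq> 0"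
  shows "smooth_on U (\<lambda>x. root 3 (f x))"
  by (rule smooth_on_compose[where V = "- {0}" and f = "root 3"])
    (use assms differentiable_upto_cube_root in
      \<open>auto simp: smooth_on_iff_differentiable_upto\<close>)

lemmas smooth_on_intros =
  smooth_on_const smooth_on_add smooth_on_mult smooth_on_minus smooth_on_diff
  smooth_on_divide smooth_on_power smooth_on_cube_root smooth_on_deriv

lemma local_diffeo_subset:
  "local_diffeo U f \<Longrightarrow> V \<subseteq> U \<Longrightarrow> open V \<Longrightarrow> local_diffeo V f"
  unfolding local_diffeo_def using smooth_on_subset inj_on_subset by blast


section \<open>Canonical coordinates of an equation\<close>

text \<open>
  The curve \<open>y = center E x\<close> is where the fifth power vanishes. A transformation of one equation
  into another maps the center of the first to that of the second, as it is affine in \<open>y\<close>.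
\<close>

definition center :: "ode \<Rightarrow> real \<Rightarrow> real" where
  "center E x = - q E x / p E x"

text \<open>
  The defect measures how far the center is from being a solution.
\<close>

definition defect :: "ode \<Rightarrow> real \<Rightarrow> real" where
  "defect E x = rhs E x (center E x) - deriv (center E) x"

text \<open>
  This is the derivative of the right-hand side in \<open>y\<close> along the center, to which the fifth power
  does not contribute.
\<close>

definition slope :: "ode \<Rightarrow> real \<Rightarrow> real" where
  "slope E x = s E x + 2 * r E x * center E x"

text \<open>
  The canonical coordinates are \<open>\<integral> x_scale dx\<close> and \<open>y_scale (y - center)\<close>. With \<open>root 3\<close> the
  exponents \<open>4/3\<close> and \<open>5/3\<close> have their usual meaning for negative coefficients too.
\<close>

definition x_scale :: "ode \<Rightarrow> real \<Rightarrow> real" where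
  "x_scale E x = root 3 (r E x) ^ 4 / root 3 (p E x) ^ 5"

definition y_scale :: "ode \<Rightarrow> real \<Rightarrow> real" where
  "y_scale E x = root 3 (p E x) ^ 5 / root 3 (r E x)"

lemma cube_root_cube: "root 3 (a :: real) ^ 3 = a"
  by (rule odd_real_root_pow) simp

lemma admissibleD:
  assumes "admissible E"
  shows "open (dom E)" "smooth_on (dom E) (p E)" "smooth_on (dom E) (q E)"
    "smooth_on (dom E) (r E)" "smooth_on (dom E) (s E)" "smooth_on (dom E) (t E)"
    "\<And>x. x \<in> dom E \<Longrightarrow> p E x \<noteq> 0" "\<And>x. x \<in> dom E \<Longrightarrow> r E x \<noteq> 0"
  using assms unfolding admissible_def by blast+

lemma smooth_center: "admissible E \<Longrightarrow> smooth_on (dom E) (center E)"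
  unfolding center_def by (intro smooth_on_intros admissibleD; assumption)

lemma smooth_x_scale: "admissible E \<Longrightarrow> smooth_on (dom E) (x_scale E)"
  unfolding x_scale_def using admissibleD[of E] by (intro smooth_on_intros) auto

lemma smooth_y_scale: "admissible E \<Longrightarrow> smooth_on (dom E) (y_scale E)"
  unfolding y_scale_def using admissibleD[of E] by (intro smooth_on_intros) auto

lemma smooth_J0: "admissible E \<Longrightarrow> smooth_on (dom E) (J0 E)"
  unfolding J0_def L2_def using admissibleD[of E] by (intro smooth_on_intros) auto

lemma smooth_J1: "admissible E \<Longrightarrow> smooth_on (dom E) (J1 E)"
  unfolding J1_def L3_def using admissibleD[of E] by (intro smooth_on_intros) auto

lemma smooth_nabla: "admissible E \<Longrightarrow> smooth_on (dom E) J \<Longrightarrow> smooth_on (dom E) (nabla E J)"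
  unfolding nabla_def using admissibleD[of E] by (intro smooth_on_intros) auto

lemma nabla_eq: "nabla E J x = deriv J x / x_scale E x"
  by (simp add: nabla_def x_scale_def)

lemma x_scale_nonzero: "admissible E \<Longrightarrow> x \<in> dom E \<Longrightarrow> x_scale E x \<noteq> 0"
  using admissibleD[of E] by (simp add: x_scale_def)

lemma y_scale_nonzero: "admissible E \<Longrightarrow> x \<in> dom E \<Longrightarrow> y_scale E x \<noteq> 0"
  using admissibleD[of E] by (simp add: y_scale_def)

lemma y_scale_cube: "y_scale E x ^ 3 = p E x ^ 5 / r E x"
proof -
  have "y_scale E x ^ 3 = (root 3 (p E x) ^ 3) ^ 5 / root 3 (r E x) ^ 3"
    by (simp add: y_scale_def power_divide flip: power_mult)
  then show ?thesis by (simp only: cube_root_cube)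
qed

text \<open>
  This and the next identity are the normalizations that define the scales: new quadratic and
  quintic coefficients equal to \<open>1\<close>.
\<close>

lemma x_scale_y_scale:
  assumes "p E x \<noteq> 0"
  shows "x_scale E x * y_scale E x = r E x"
proof -
  have "x_scale E x * y_scale E x = root 3 (r E x) ^ 3"
    using assms by (simp add: x_scale_def y_scale_def field_simps eval_nat_numeral)
  then show ?thesis by (simp only: cube_root_cube)
qed

lemma x_scale_y_scale4:
  assumes "p E x \<noteq> 0" "r E x \<noteq> 0"
  shows "x_scale E x * y_scale E x ^ 4 = p E x ^ 5"
proof -
  have "x_scale E x * y_scale E x ^ 4 = x_scale E x * y_scale E x * y_scale E x ^ 3"
    by (simp add: eval_nat_numeral)
  then show ?thesis using assms by (simp add: x_scale_y_scale y_scale_cube)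
qed

text \<open>
  In powers of \<open>y - center\<close> the right-hand side has no terms of degree 3 and 4; transformations
  then act on the remaining coefficients by scaling.
\<close>

lemma rhs_centered:
  assumes "p E x \<noteq> 0"
  shows "rhs E x y = p E x ^ 5 * (y - center E x) ^ 5 + r E x * (y - center E x)\<^sup>2
    + slope E x * (y - center E x) + rhs E x (center E x)"
proof -
  have 1: "p E x * y + q E x = p E x * (y - center E x)" for y
    using assms by (simp add: center_def field_simps)
  show ?thesis
    unfolding rhs_def 1 slope_def power_mult_distrib by (simp add: power2_eq_square algebra_simps)
qed

text \<open>
  \<open>L2\<close> is \<open>p\<^sup>2\<close> times the defect. The factor \<open>y_scale / x_scale\<close> converts a \<open>y'\<close> to canonical units.
\<close>

lemma J0_eq:
  assumes "admissible E" "x \<in> dom E"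
  shows "J0 E x = defect E x * y_scale E x / x_scale E x"
proof -
  note E = admissibleD[OF assms(1)]
  have nz: "p E x \<noteq> 0" "r E x \<noteq> 0" using E assms by auto
  have "(center E has_real_derivative
      - ((deriv (q E) x * p E x - q E x * deriv (p E) x) / (p E x * p E x))) (at x)"
    unfolding center_def
    using nz by (auto intro!: derivative_eq_intros smooth_on_DERIV[OF E(2)] smooth_on_DERIV[OF E(3)] assms
        simp: field_simps)
  then have dc: "deriv (center E) x =
      - ((deriv (q E) x * p E x - q E x * deriv (p E) x) / (p E x * p E x))"
    by (rule DERIV_imp_deriv)
  have rhs_center: "rhs E x (center E x) = r E x * (center E x)\<^sup>2 + s E x * center E x + t E x"
    using nz by (simp add: rhs_def center_def)
  have L2: "L2 E x = (p E x)\<^sup>2 * defect E x"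
    using nz unfolding defect_def dc L2_def rhs_center
    by (simp add: center_def field_simps power2_eq_square)
  define a b where "a = root 3 (p E x)" and "b = root 3 (r E x)"
  have ab: "p E x = a ^ 3" "a \<noteq> 0" "b \<noteq> 0"
    using nz by (simp_all add: a_def b_def cube_root_cube)
  show ?thesis
    unfolding J0_def L2 y_scale_def x_scale_def a_def[symmetric] b_def[symmetric] 
    unfolding ab using ab(2,3) by (simp add: field_simps eval_nat_numeral)
qed

text \<open>
  For \<open>y_scale (y - center)\<close> as a function of the original \<open>x\<close>, the linear coefficient is the
  slope plus the logarithmic derivative of \<open>y_scale\<close>, and \<open>L3\<close> is this multiplied by \<open>3 p r\<close>. The logarithmic derivative
  comes from \<open>y_scale\<^sup>3 = p\<^sup>5 / r\<close>.
\<close>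

lemma J1_eq:
  assumes "admissible E" "x \<in> dom E"
  shows "J1 E x = 3 * (slope E x + deriv (y_scale E) x / y_scale E x) / x_scale E x"
proof -
  note E = admissibleD[OF assms(1)]
  have nz: "p E x \<noteq> 0" "r E x \<noteq> 0" using E assms by auto
  have nu: "y_scale E x \<noteq> 0" using y_scale_nonzero assms by blast
  have "((\<lambda>x. y_scale E x ^ 3 * r E x) has_real_derivative
      3 * y_scale E x ^ 2 * deriv (y_scale E) x * r E x + y_scale E x ^ 3 * deriv (r E) x) (at x)"
    by (auto intro!: derivative_eq_intros smooth_on_DERIV[OF E(4)]
        smooth_on_DERIV[OF smooth_y_scale] assms)
  moreover have "((\<lambda>x. p E x ^ 5) has_real_derivative 5 * p E x ^ 4 * deriv (p E) x) (at x)"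
    by (auto intro!: derivative_eq_intros smooth_on_DERIV[OF E(2)] assms)
  then have "((\<lambda>x. y_scale E x ^ 3 * r E x) has_real_derivative 5 * p E x ^ 4 * deriv (p E) x) (at x)"
    by (rule has_field_derivative_transform_within_open[OF _ E(1) assms(2)])
      (simp add: y_scale_cube E)
  ultimately have d: "3 * y_scale E x ^ 2 * deriv (y_scale E) x * r E x + y_scale E x ^ 3 * deriv (r E) x
      = 5 * p E x ^ 4 * deriv (p E) x"
    by (rule DERIV_unique)
  have c: "y_scale E x ^ 3 * r E x = p E x ^ 5" using nz by (simp add: y_scale_cube)
  have log: "3 * (deriv (y_scale E) x / y_scale E x)
      = 5 * deriv (p E) x / p E x - deriv (r E) x / r E x"
  proof (rule mult_left_cancel[THEN iffD1])
    show "y_scale E x ^ 3 * r E x \<noteq> 0" using nu nz by simp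
    have "y_scale E x ^ 3 * r E x * (3 * (deriv (y_scale E) x / y_scale E x))
        = 3 * y_scale E x ^ 2 * deriv (y_scale E) x * r E x"
      using nu by (simp add: field_simps eval_nat_numeral)
    also have "\<dots> = 5 * p E x ^ 4 * deriv (p E) x - y_scale E x ^ 3 * deriv (r E) x"
      using d by simp
    also have "\<dots> = p E x ^ 5 * (5 * deriv (p E) x / p E x) - y_scale E x ^ 3 * r E x * (deriv (r E) x / r E x)"
      using nz by (simp add: eval_nat_numeral)
    finally show "y_scale E x ^ 3 * r E x * (3 * (deriv (y_scale E) x / y_scale E x))
        = y_scale E x ^ 3 * r E x * (5 * deriv (p E) x / p E x - deriv (r E) x / r E x)"
      unfolding c by (simp add: right_diff_distrib)
  qed
  have L3: "L3 E x = p E x * r E x * (3 * (slope E x + deriv (y_scale E) x / y_scale E x))"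
    using nz unfolding distrib_left[of 3] log L3_def slope_def center_def
    by (simp add: field_simps power2_eq_square)
  define a b where "a = root 3 (p E x)" and "b = root 3 (r E x)"
  have ab: "p E x = a ^ 3" "r E x = b ^ 3" "a \<noteq> 0" "b \<noteq> 0"
    using nz by (simp_all add: a_def b_def cube_root_cube)
  have w: "p E x * r E x * root 3 (p E x) ^ 2 / root 3 (r E x) ^ 7 = 1 / x_scale E x"
    unfolding x_scale_def a_def[symmetric] b_def[symmetric] 
    unfolding ab using ab(3,4) by (simp add: field_simps flip: power_add power_mult)
  have "J1 E x = (p E x * r E x * root 3 (p E x) ^ 2 / root 3 (r E x) ^ 7)
      * (3 * (slope E x + deriv (y_scale E) x / y_scale E x))"
    unfolding J1_def L3 by simp
  then show ?thesis unfolding w by simp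
qed


section \<open>Equivalence in canonical coordinates\<close>

text \<open>
  Six values determine a quintic; the small integers make this a linear system that
  simplification solves.
\<close>

lemma quintic_zero_coeffs:
  fixes a5 a4 a3 a2 a1 a0 :: real
  assumes "\<And>y. a5 * y ^ 5 + a4 * y ^ 4 + a3 * y ^ 3 + a2 * y\<^sup>2 + a1 * y + a0 = 0"
  shows "a5 = 0 \<and> a4 = 0 \<and> a3 = 0 \<and> a2 = 0 \<and> a1 = 0 \<and> a0 = 0"
  using assms[of 0] assms[of 1] assms[of "-1"] assms[of 2] assms[of "-2"] assms[of 3] by simp

text \<open>
  The missing term of degree 4 pins down the center: shifting a quintic with non-zero leading
  coefficient creates such a term.
\<close>

lemma centered_quintic_unique:
  fixes a c :: real
  assumes "a \<noteq> 0"
    and eq: "\<And>y. a * (y - c) ^ 5 + a2 * (y - c)\<^sup>2 + a1 * (y - c) + a0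
              = b * (y - d) ^ 5 + b2 * (y - d)\<^sup>2 + b1 * (y - d) + b0"
  shows "c = d \<and> a = b \<and> a2 = b2 \<and> a1 = b1 \<and> a0 = b0"
proof -
  define e where "e = c - d"
  have "(a - b) * z ^ 5 + (- 5 * b * e) * z ^ 4 + (- 10 * b * e\<^sup>2) * z ^ 3
      + (a2 - b2 - 10 * b * e ^ 3) * z\<^sup>2 + (a1 - b1 - 2 * b2 * e - 5 * b * e ^ 4) * z
      + (a0 - b0 - b * e ^ 5 - b2 * e\<^sup>2 - b1 * e) = 0" for z
    \<comment> \<open>With \<open>y = z + c\<close> one has \<open>y - d = z + e\<close>; the coefficients are those of the difference of
      the two sides, expanded in \<open>z\<close>.\<close>
    using eq[of "z + c"]
    unfolding diff_conv_add_uminus[of "z + c"] add.assoc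
    by (simp add: e_def) (simp add: algebra_simps eval_nat_numeral)
  note 0 = quintic_zero_coeffs[OF this]
  then have "b = a" "e = 0" using \<open>a \<noteq> 0\<close> by auto
  with 0 show ?thesis by (simp add: e_def)
qed

text \<open>
  Dividing \<open>p\<^sup>5 = x_scale \<cdot> y_scale\<^sup>4\<close> by \<open>r = x_scale \<cdot> y_scale\<close> leaves a cube, and real cube roots are
  unique; so the two leading coefficients carry the same information as the two scales. Here \<open>a\<close>
  and \<open>b\<close> stand for the values of \<open>f'\<close> and \<open>g\<close>.
\<close>

lemma scale_unique:
  assumes "admissible E" "admissible F" "u \<in> dom E" "v \<in> dom F" "a \<noteq> 0" "b \<noteq> 0"
  shows "(p E u ^ 5 = a * p F v ^ 5 * b ^ 4 \<and> r E u = a * r F v * b) \<longleftrightarrow>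
    (a * x_scale F v = x_scale E u \<and> b * y_scale F v = y_scale E u)"
proof -
  have nz: "p E u \<noteq> 0" "r E u \<noteq> 0" "p F v \<noteq> 0" "r F v \<noteq> 0"
    using assms admissibleD by blast+
  have sc: "x_scale E u \<noteq> 0" "y_scale E u \<noteq> 0" "x_scale F v \<noteq> 0" "y_scale F v \<noteq> 0"
    using assms x_scale_nonzero y_scale_nonzero by blast+
  show ?thesis (is "?L \<longleftrightarrow> ?R")
  proof
    assume R: ?R
    have "p E u ^ 5 = x_scale E u * y_scale E u ^ 4" by (simp add: x_scale_y_scale4 nz)
    also have "\<dots> = a * (x_scale F v * y_scale F v ^ 4) * b ^ 4"
      by (simp add: power_mult_distrib flip: conjunct1[OF R] conjunct2[OF R])
    finally have 1: "p E u ^ 5 = a * p F v ^ 5 * b ^ 4" by (simp add: x_scale_y_scale4 nz)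
    have "r E u = x_scale E u * y_scale E u" by (simp add: x_scale_y_scale nz)
    also have "\<dots> = a * (x_scale F v * y_scale F v) * b"
      by (simp flip: conjunct1[OF R] conjunct2[OF R])
    finally show ?L using 1 by (simp add: x_scale_y_scale nz)
  next
    assume L: ?L
    have "y_scale E u ^ 3 = (a * p F v ^ 5 * b ^ 4) / (a * r F v * b)"
      using L by (simp add: y_scale_cube)
    also have "\<dots> = (b * y_scale F v) ^ 3"
      unfolding power_mult_distrib y_scale_cube
      using nz \<open>a \<noteq> 0\<close> \<open>b \<noteq> 0\<close> by (simp add: field_simps eval_nat_numeral)
    finally have "(b * y_scale F v) ^ 3 = y_scale E u ^ 3" ..
    then have b: "b * y_scale F v = y_scale E u"
      using odd_real_root_power_cancel[of 3] by (metis odd_numeral)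
    have "a * x_scale F v * y_scale E u = a * (x_scale F v * y_scale F v) * b"
      by (simp flip: b)
    also have "\<dots> = x_scale E u * y_scale E u"
      using L x_scale_y_scale[OF nz(1)] x_scale_y_scale[OF nz(3)] by simp
    finally show ?R using b sc by simp
  qed
qed

text \<open>
  The transformation is bijective on each fibre over \<open>x\<close>, so equality of the surfaces is no more
  than the inclusion of the image.
\<close>

lemma prolong_surface_iff:
  assumes "point_transformation U f g h"
  shows "prolong f g h ` ode_surface E U = ode_surface F (f ` U) \<longleftrightarrow>
    (\<forall>u\<in>U. \<forall>y. deriv g u * y + g u * rhs E u y + deriv h u = deriv f u * rhs F (f u) (g u * y + h u))"
    (is "?L \<longleftrightarrow> ?R")
proof -
  have f: "\<And>u. u \<in> U \<Longrightarrow> deriv f u \<noteq> 0" and g: "\<And>u. u \<in> U \<Longrightarrow> g u \<noteq> 0"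
    using assms unfolding point_transformation_def local_diffeo_def by auto
  have img: "prolong f g h ` ode_surface E U =
      {(f u, g u * y + h u, (deriv g u * y + g u * rhs E u y + deriv h u) / deriv f u) |u y. u \<in> U}"
    unfolding ode_surface_def prolong_def by force
  show ?thesis
  proof
    assume ?L
    show ?R
    proof (intro ballI allI)
      fix u y assume u: "u \<in> U"
      then have "(f u, g u * y + h u, (deriv g u * y + g u * rhs E u y + deriv h u) / deriv f u)
          \<in> ode_surface F (f ` U)"
        using \<open>?L\<close> img by blast
      then show "deriv g u * y + g u * rhs E u y + deriv h u = deriv f u * rhs F (f u) (g u * y + h u)"
        using f[OF u] by (auto simp: ode_surface_def field_simps)
    qed
  next
    assume ?R
    then have R: "(deriv g u * y + g u * rhs E u y + deriv h u) / deriv f u = rhs F (f u) (g u * y + h u)"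
      if "u \<in> U" for u y
      using that f[OF that] by (simp add: field_simps)
    show ?L
    proof
      show "prolong f g h ` ode_surface E U \<subseteq> ode_surface F (f ` U)"
        unfolding img by (auto simp: ode_surface_def R)
      show "ode_surface F (f ` U) \<subseteq> prolong f g h ` ode_surface E U"
      proof
        fix z assume "z \<in> ode_surface F (f ` U)"
        then obtain u y where u: "u \<in> U" and z: "z = (f u, y, rhs F (f u) y)"
          unfolding ode_surface_def by auto
        have y: "g u * ((y - h u) / g u) + h u = y" using g[OF u] by simp
        show "z \<in> prolong f g h ` ode_surface E U"
          unfolding img z using u R[OF u, of "(y - h u) / g u"] y
          by (intro CollectI exI[of _ u] exI[of _ "(y - h u) / g u"]) simp
      qed
    qed
  qed
qed

text \<open>
  At one point, with \<open>g0, g1, h0, h1, f1\<close> for the values of \<open>g, g', h, h', f'\<close>: both sides are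
  centered quintics in \<open>y\<close>, so they agree if and only if their centers and coefficients do.
\<close>

lemma transformed_iff_coeffs:
  assumes nz: "p E u \<noteq> 0" "p F v \<noteq> 0" and g: "g0 \<noteq> (0 :: real)"
  shows "(\<forall>y. g1 * y + g0 * rhs E u y + h1 = f1 * rhs F v (g0 * y + h0)) \<longleftrightarrow>
    center F v = g0 * center E u + h0 \<and>
    p E u ^ 5 = f1 * p F v ^ 5 * g0 ^ 4 \<and> r E u = f1 * r F v * g0 \<and>
    g1 + g0 * slope E u = f1 * slope F v * g0 \<and>
    g1 * center E u + h1 + g0 * rhs E u (center E u) = f1 * rhs F v (center F v)"
    (is "?L \<longleftrightarrow> ?R")
proof -
  define c d where "c = center E u" and "d = (center F v - h0) / g0"
  \<comment> \<open>\<open>d\<close> is the preimage of the center of \<open>F\<close>.\<close>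
  have d: "g0 * y + h0 - center F v = g0 * (y - d)" for y
    using g by (simp add: d_def field_simps)
  have l: "g1 * y + g0 * rhs E u y + h1 =
      (g0 * p E u ^ 5) * (y - c) ^ 5 + (g0 * r E u) * (y - c)\<^sup>2 + (g1 + g0 * slope E u) * (y - c)
      + (g1 * c + h1 + g0 * rhs E u (center E u))" for y
    unfolding rhs_centered[OF nz(1), of y] c_def by (simp add: algebra_simps)
  have rr: "f1 * rhs F v (g0 * y + h0) =
      (f1 * p F v ^ 5 * g0 ^ 5) * (y - d) ^ 5 + (f1 * r F v * g0\<^sup>2) * (y - d)\<^sup>2
      + (f1 * slope F v * g0) * (y - d) + f1 * rhs F v (center F v)" for y
    unfolding rhs_centered[OF nz(2), of "g0 * y + h0"] d power_mult_distrib
    by (simp add: algebra_simps)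
  have "?L \<longleftrightarrow> c = d \<and> g0 * p E u ^ 5 = f1 * p F v ^ 5 * g0 ^ 5 \<and> g0 * r E u = f1 * r F v * g0\<^sup>2 \<and>
      g1 + g0 * slope E u = f1 * slope F v * g0 \<and>
      g1 * c + h1 + g0 * rhs E u (center E u) = f1 * rhs F v (center F v)"
    unfolding l rr
  proof (intro iffI allI; (elim conjE)?)
    show "c = d \<and> g0 * p E u ^ 5 = f1 * p F v ^ 5 * g0 ^ 5 \<and> g0 * r E u = f1 * r F v * g0\<^sup>2 \<and>
        g1 + g0 * slope E u = f1 * slope F v * g0 \<and>
        g1 * c + h1 + g0 * rhs E u (center E u) = f1 * rhs F v (center F v)"
      if "\<forall>y. (g0 * p E u ^ 5) * (y - c) ^ 5 + (g0 * r E u) * (y - c)\<^sup>2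
            + (g1 + g0 * slope E u) * (y - c) + (g1 * c + h1 + g0 * rhs E u (center E u))
          = (f1 * p F v ^ 5 * g0 ^ 5) * (y - d) ^ 5 + (f1 * r F v * g0\<^sup>2) * (y - d)\<^sup>2
            + (f1 * slope F v * g0) * (y - d) + f1 * rhs F v (center F v)"
      by (rule centered_quintic_unique[OF _ that[rule_format]]) (use g nz in simp)
  qed (simp only:)
  also have "\<dots> \<longleftrightarrow> ?R"
  proof (intro conj_cong)
    show "c = d \<longleftrightarrow> center F v = g0 * center E u + h0"
      using g by (auto simp: c_def d_def field_simps)
    show "g0 * p E u ^ 5 = f1 * p F v ^ 5 * g0 ^ 5 \<longleftrightarrow> p E u ^ 5 = f1 * p F v ^ 5 * g0 ^ 4"
      using g by (auto simp: eval_nat_numeral)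
    show "g0 * r E u = f1 * r F v * g0\<^sup>2 \<longleftrightarrow> r E u = f1 * r F v * g0"
      using g by (auto simp: power2_eq_square)
  qed (simp_all add: c_def)
  finally show ?thesis .
qed

text \<open>
  The conditions on the center and the two scales hold along all of \<open>U\<close>, so they may be
  differentiated. Substituting the derivatives of \<open>g\<close> and \<open>h\<close> found in this way turns the condition
  on the linear coefficient into \<open>J1 E = J1 F \<circ> f\<close> and the one on the constant coefficient, which
  now says that defects scale like \<open>y'\<close>, into \<open>J0 E = J0 F \<circ> f\<close>.
\<close>

lemma transforms_iff_invariants:
  assumes E: "admissible E" and F: "admissible F"
    and T: "point_transformation U f g h" and UE: "U \<subseteq> dom E" and UF: "f ` U \<subseteq> dom F"
  shows "prolong f g h ` ode_surface E U = ode_surface F (f ` U) \<longleftrightarrow>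
    (\<forall>u\<in>U. g u = y_scale E u / y_scale F (f u) \<and> h u = center F (f u) - g u * center E u) \<and>
    (\<forall>u\<in>U. deriv f u * x_scale F (f u) = x_scale E u \<and>
       J0 E u = J0 F (f u) \<and> J1 E u = J1 F (f u))"
    (is "?L \<longleftrightarrow> ?R")
proof -
  have U: "open U" and sf: "smooth_on U f" and sg: "smooth_on U g" and sh: "smooth_on U h"
    and f0: "\<And>u. u \<in> U \<Longrightarrow> deriv f u \<noteq> 0" and g0: "\<And>u. u \<in> U \<Longrightarrow> g u \<noteq> 0"
    using T by (auto simp: point_transformation_def local_diffeo_def)
  \<comment> \<open>The part of the condition that can be differentiated.\<close>
  define A where "A \<longleftrightarrow> (\<forall>u\<in>U. deriv f u * x_scale F (f u) = x_scale E u \<and>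
      g u * y_scale F (f u) = y_scale E u \<and> center F (f u) = g u * center E u + h u)"
  have "?L \<longleftrightarrow> A \<and> (\<forall>u\<in>U. deriv g u + g u * slope E u = deriv f u * slope F (f u) * g u \<and>
      deriv g u * center E u + deriv h u + g u * rhs E u (center E u)
        = deriv f u * rhs F (f u) (center F (f u)))"
  proof -
    have nz: "p E u \<noteq> 0" "p F (f u) \<noteq> 0" if "u \<in> U" for u
      using that UE UF admissibleD(7)[OF E] admissibleD(7)[OF F] by auto
    have sc: "(p E u ^ 5 = deriv f u * p F (f u) ^ 5 * g u ^ 4 \<and> r E u = deriv f u * r F (f u) * g u) \<longleftrightarrow>
      (deriv f u * x_scale F (f u) = x_scale E u \<and> g u * y_scale F (f u) = y_scale E u)" 
      if "u \<in> U" for u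
      using scale_unique[OF E F _ _ f0 g0] that UE UF by blast
    show ?thesis
      unfolding prolong_surface_iff[OF T] A_def
      using transformed_iff_coeffs[OF nz g0] sc by (auto simp: Ball_def)
  qed
  also have "\<dots> \<longleftrightarrow> A \<and> (\<forall>u\<in>U. J1 E u = J1 F (f u) \<and> J0 E u = J0 F (f u))"
  proof (intro conj_cong refl ball_cong)
    fix u assume A and u: "u \<in> U"
    then have uE: "u \<in> dom E" and uF: "f u \<in> dom F" using UE UF by auto
    have a: "deriv f u * x_scale F (f u) = x_scale E u" "g u * y_scale F (f u) = y_scale E u"
      using \<open>A\<close> u unfolding A_def by auto
    have sc: "x_scale E u \<noteq> 0" "y_scale E u \<noteq> 0" "x_scale F (f u) \<noteq> 0" "y_scale F (f u) \<noteq> 0"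
      using E F uE uF x_scale_nonzero y_scale_nonzero by blast+
    note df = smooth_on_DERIV[OF sf u] and dg = smooth_on_DERIV[OF sg u]
      and dh = smooth_on_DERIV[OF sh u]
    have "((\<lambda>u. g u * y_scale F (f u)) has_real_derivative deriv (y_scale E) u) (at u)"
      by (rule has_field_derivative_transform_within_open
          [OF smooth_on_DERIV[OF smooth_y_scale[OF E] uE] U u]) (use \<open>A\<close> in \<open>simp add: A_def\<close>)
    moreover have "((\<lambda>u. g u * y_scale F (f u)) has_real_derivative
        deriv g u * y_scale F (f u) + deriv (y_scale F) (f u) * deriv f u * g u) (at u)"
      by (intro DERIV_mult dg DERIV_chain2[OF smooth_on_DERIV[OF smooth_y_scale[OF F] uF] df])
    ultimately have dy: "deriv (y_scale E) u
        = deriv g u * y_scale F (f u) + deriv (y_scale F) (f u) * deriv f u * g u"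
      by (rule DERIV_unique)
    have "((\<lambda>u. g u * center E u + h u) has_real_derivative
        deriv (center F) (f u) * deriv f u) (at u)"
      by (rule has_field_derivative_transform_within_open
          [OF DERIV_chain2[OF smooth_on_DERIV[OF smooth_center[OF F] uF] df] U u])
        (use \<open>A\<close> in \<open>simp add: A_def\<close>)
    moreover have "((\<lambda>u. g u * center E u + h u) has_real_derivative
        deriv g u * center E u + deriv (center E) u * g u + deriv h u) (at u)"
      by (intro DERIV_add DERIV_mult dg dh smooth_on_DERIV[OF smooth_center[OF E] uE])
    ultimately have dc: "deriv (center F) (f u) * deriv f u
        = deriv g u * center E u + deriv (center E) u * g u + deriv h u"
      by (rule DERIV_unique)
    have cancel: "3 * A / (b * X) = 3 * B / X \<longleftrightarrow> A = b * B" if "b \<noteq> 0" "X \<noteq> 0" for A B b X :: real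
      using that by (auto simp: field_simps)
    note [simp] = f0[OF u] g0[OF u] sc(3,4)
    have "J1 E u = J1 F (f u) \<longleftrightarrow> slope E u + deriv (y_scale E) u / y_scale E u
        = deriv f u * (slope F (f u) + deriv (y_scale F) (f u) / y_scale F (f u))"
      unfolding J1_eq[OF E uE] J1_eq[OF F uF] a(1)[symmetric] by (rule cancel) simp_all
    also have "deriv (y_scale E) u / y_scale E u
        = deriv g u / g u + deriv f u * (deriv (y_scale F) (f u) / y_scale F (f u))"
      unfolding dy a(2)[symmetric] by (simp add: field_simps)
    finally have "J1 E u = J1 F (f u) \<longleftrightarrow> slope E u + deriv g u / g u = deriv f u * slope F (f u)"
      by (simp add: distrib_left)
    then show "deriv g u + g u * slope E u = deriv f u * slope F (f u) * g u \<longleftrightarrow>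
        J1 E u = J1 F (f u)"
      by (auto simp: field_simps)
    have "J0 E u = J0 F (f u) \<longleftrightarrow> g u * defect E u = deriv f u * defect F (f u)"
      unfolding J0_eq[OF E uE] J0_eq[OF F uF] a[symmetric] by (auto simp: field_simps)
    then show "deriv g u * center E u + deriv h u + g u * rhs E u (center E u)
        = deriv f u * rhs F (f u) (center F (f u)) \<longleftrightarrow> J0 E u = J0 F (f u)"
      using dc by (auto simp: defect_def algebra_simps)
  qed
  also have "\<dots> \<longleftrightarrow> ?R"
  proof -
    have "g u = y_scale E u / y_scale F (f u) \<longleftrightarrow> g u * y_scale F (f u) = y_scale E u" if "u \<in> U" for u
      using y_scale_nonzero[OF F, of "f u"] that UF by (auto simp: field_simps)
    then show ?thesis unfolding A_def by (auto simp: algebra_simps)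
  qed
  finally show ?thesis .
qed

text \<open>
  Equivalence becomes a condition on the change of variable \<open>f\<close> alone: \<open>g\<close> and \<open>h\<close> are the affine
  map that matches centers and scales, and they are smooth because these are.
\<close>

lemma G_equivalent_near_iff:
  assumes E: "admissible E" and F: "admissible F"
  shows "G_equivalent_near E F x \<longleftrightarrow>
    (\<exists>U f. x \<in> U \<and> U \<subseteq> dom E \<and> local_diffeo U f \<and> f ` U \<subseteq> dom F \<and>
      (\<forall>u\<in>U. deriv f u * x_scale F (f u) = x_scale E u \<and>
         J0 E u = J0 F (f u) \<and> J1 E u = J1 F (f u)))"
    (is "_ \<longleftrightarrow> ?R")
proof
  assume "G_equivalent_near E F x"
  then obtain U f g h where U: "x \<in> U" "U \<subseteq> dom E" "f ` U \<subseteq> dom F"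
    and T: "point_transformation U f g h"
    and "prolong f g h ` ode_surface E U = ode_surface F (f ` U)"
    unfolding G_equivalent_near_def by blast
  then have "\<forall>u\<in>U. deriv f u * x_scale F (f u) = x_scale E u \<and>
         J0 E u = J0 F (f u) \<and> J1 E u = J1 F (f u)"
    using transforms_iff_invariants[OF E F T] by blast
  moreover have "local_diffeo U f" using T by (simp add: point_transformation_def)
  ultimately show ?R using U by blast
next
  assume ?R
  then obtain U f where U: "x \<in> U" "U \<subseteq> dom E" "f ` U \<subseteq> dom F" and f: "local_diffeo U f"
    and inv: "\<forall>u\<in>U. deriv f u * x_scale F (f u) = x_scale E u \<and>
         J0 E u = J0 F (f u) \<and> J1 E u = J1 F (f u)"
    by blast
  define g where "g u = y_scale E u / y_scale F (f u)" for u
  define h where "h u = center F (f u) - g u * center E u" for u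
  have oU: "open U" and sf: "smooth_on U f" using f by (auto simp: local_diffeo_def)
  have nz: "y_scale E u \<noteq> 0" "y_scale F (f u) \<noteq> 0" if "u \<in> U" for u
    using that U y_scale_nonzero[OF E] y_scale_nonzero[OF F] by auto
  note comp = smooth_on_compose[OF oU _ sf U(3)]
  have sg: "smooth_on U g"
    unfolding g_def using nz
    by (intro smooth_on_divide[OF oU] comp smooth_y_scale F smooth_on_subset[OF smooth_y_scale[OF E] U(2)])
  have sh: "smooth_on U h"
    unfolding h_def
    by (intro smooth_on_diff[OF oU] smooth_on_mult[OF oU] comp smooth_center F sg
        smooth_on_subset[OF smooth_center[OF E] U(2)])
  have T: "point_transformation U f g h"
    using f sg sh nz by (simp add: point_transformation_def g_def)
  have "prolong f g h ` ode_surface E U = ode_surface F (f ` U)"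
    unfolding transforms_iff_invariants[OF E F T U(2,3)] using inv by (simp add: g_def h_def)
  then show "G_equivalent_near E F x"
    unfolding G_equivalent_near_def using U T by blast
qed


section \<open>Recovering the change of variable from the invariants\<close>

text \<open>
  This is the chain rule, written as an equality of the differentials \<open>dJ = nabla J \<cdot> x_scale dx\<close>.
\<close>

lemma nabla_naturality:
  assumes E: "admissible E" and F: "admissible F"
    and f: "local_diffeo U f" and U: "U \<subseteq> dom E" "f ` U \<subseteq> dom F" and u: "u \<in> U"
    and K: "smooth_on (dom F) K" and JK: "\<And>u. u \<in> U \<Longrightarrow> J u = K (f u)"
  shows "nabla E J u * x_scale E u = nabla F K (f u) * (deriv f u * x_scale F (f u))"
proof -
  have oU: "open U" and sf: "smooth_on U f" using f by (auto simp: local_diffeo_def)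
  have uF: "f u \<in> dom F" and uE: "u \<in> dom E" using u U by auto
  have "(J has_real_derivative deriv K (f u) * deriv f u) (at u)"
    by (rule has_field_derivative_transform_within_open
        [OF DERIV_chain2[OF smooth_on_DERIV[OF K uF] smooth_on_DERIV[OF sf u]] oU u])
      (simp add: JK)
  then have "deriv J u = deriv K (f u) * deriv f u" by (rule DERIV_imp_deriv)
  then show ?thesis
    using x_scale_nonzero[OF E uE] x_scale_nonzero[OF F uF] by (simp add: nabla_eq)
qed

lemma eventually_nonzero_of_deriv:
  fixes k :: "real \<Rightarrow> real"
  assumes k: "(k has_real_derivative d) (at x)" and "k x \<noteq> 0 \<or> d \<noteq> 0"
  shows "\<forall>\<^sub>F u in at x. k u \<noteq> 0"
proof (cases "k x = 0")
  case True
  have "((\<lambda>u. (k u - k x) / (u - x)) \<longlongrightarrow> d) (at x)"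
    using k by (simp add: has_field_derivative_iff)
  then have "\<forall>\<^sub>F u in at x. (k u - k x) / (u - x) \<noteq> 0"
    using True assms(2) by (intro tendsto_imp_eventually_ne) auto
  then show ?thesis using True by (auto elim: eventually_mono)
next
  case False
  then show ?thesis
    using DERIV_isCont[OF k] by (auto simp: isCont_def intro: tendsto_imp_eventually_ne)
qed

text \<open>
  A point where \<open>J\<close> is critical but \<open>nabla J\<close> has non-zero derivative is an isolated zero of
  \<open>nabla J\<close>; the point itself is therefore excluded here.
\<close>

lemma eventually_nabla_nonzero:
  assumes E: "admissible E" and x: "x \<in> dom E" and J: "smooth_on (dom E) J"
    and "deriv J x \<noteq> 0 \<or> deriv (nabla E J) x \<noteq> 0"
  shows "\<forall>\<^sub>F u in at x. nabla E J u \<noteq> 0"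
  by (rule eventually_nonzero_of_deriv[OF smooth_on_DERIV[OF smooth_nabla[OF E J] x]])
    (use assms(4) x_scale_nonzero[OF E x] in \<open>auto simp: nabla_eq\<close>)

theorem theorem10:
  fixes E F :: ode and x :: real
  assumes "admissible E" and "admissible F" and "x \<in> dom E"
    and regular: "deriv (J0 E) x \<noteq> 0 \<or> deriv (J1 E) x \<noteq> 0 \<or>
      deriv (nabla E (J0 E)) x \<noteq> 0 \<or> deriv (nabla E (J1 E)) x \<noteq> 0"
  shows "G_equivalent_near E F x \<longleftrightarrow>
    (\<exists>U \<phi>. x \<in> U \<and> U \<subseteq> dom E \<and> local_diffeo U \<phi> \<and> \<phi> ` U \<subseteq> dom F \<and>
      (\<forall>u\<in>U. J0 E u = J0 F (\<phi> u) \<and>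
             J1 E u = J1 F (\<phi> u) \<and>
             nabla E (J0 E) u = nabla F (J0 F) (\<phi> u) \<and>
             nabla E (J1 E) u = nabla F (J1 F) (\<phi> u)))"
    (is "_ \<longleftrightarrow> ?R")
proof -
  note E = assms(1) and F = assms(2)
  note nat = nabla_naturality[OF E F]
  show ?thesis
    unfolding G_equivalent_near_iff[OF E F]
  proof (intro iffI; elim exE conjE)
    fix U f
    assume U: "x \<in> U" "U \<subseteq> dom E" "f ` U \<subseteq> dom F" and f: "local_diffeo U f"
      and inv: "\<forall>u\<in>U. deriv f u * x_scale F (f u) = x_scale E u \<and>
         J0 E u = J0 F (f u) \<and> J1 E u = J1 F (f u)"
    have "nabla E (J0 E) u = nabla F (J0 F) (f u) \<and> nabla E (J1 E) u = nabla F (J1 F) (f u)"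
      if u: "u \<in> U" for u
      using nat[OF f U(2,3) u smooth_J0[OF F], of "J0 E"]
        nat[OF f U(2,3) u smooth_J1[OF F], of "J1 E"] inv u U(2) x_scale_nonzero[OF E, of u]
      by auto
    with inv show ?R using U f by blast
  next
    fix U f
    assume U: "x \<in> U" "U \<subseteq> dom E" "f ` U \<subseteq> dom F" and f: "local_diffeo U f"
      and inv: "\<forall>u\<in>U. J0 E u = J0 F (f u) \<and> J1 E u = J1 F (f u) \<and>
             nabla E (J0 E) u = nabla F (J0 F) (f u) \<and> nabla E (J1 E) u = nabla F (J1 F) (f u)"
    have oU: "open U" and sf: "smooth_on U f" using f by (auto simp: local_diffeo_def)
    \<comment> \<open>The function \<open>d\<close> vanishes if and only if \<open>f\<close> carries one scaling form to the other.\<close>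
    define d where "d u = x_scale E u - deriv f u * x_scale F (f u)" for u
    have "smooth_on U d"
      unfolding d_def
      by (intro smooth_on_diff[OF oU] smooth_on_mult[OF oU] smooth_on_deriv sf
          smooth_on_subset[OF smooth_x_scale[OF E] U(2)]
          smooth_on_compose[OF oU smooth_x_scale[OF F] sf U(3)])
    then have "isCont d x" using U(1) by (rule smooth_on_isCont)
    have prod: "nabla E (J0 E) u * d u = 0" "nabla E (J1 E) u * d u = 0" if u: "u \<in> U" for u
      using nat[OF f U(2,3) u smooth_J0[OF F], of "J0 E"]
        nat[OF f U(2,3) u smooth_J1[OF F], of "J1 E"] inv u
      by (simp_all add: d_def right_diff_distrib)
    have near: "\<forall>\<^sub>F u in at x. u \<in> U"
      using oU U(1) eventually_at_topological by blast
    have "(\<forall>\<^sub>F u in at x. nabla E (J0 E) u \<noteq> 0) \<or> (\<forall>\<^sub>F u in at x. nabla E (J1 E) u \<noteq> 0)"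
      using regular eventually_nabla_nonzero[OF E assms(3)] smooth_J0[OF E] smooth_J1[OF E] by blast
    then have d0: "\<forall>\<^sub>F u in at x. d u = 0"
    proof
      assume "\<forall>\<^sub>F u in at x. nabla E (J0 E) u \<noteq> 0"
      with near show ?thesis by eventually_elim (use prod in force)
    next
      assume "\<forall>\<^sub>F u in at x. nabla E (J1 E) u \<noteq> 0"
      with near show ?thesis by eventually_elim (use prod in force)
    qed
    have "(d \<longlongrightarrow> 0) (at x)"
      by (rule tendsto_eventually[OF d0])
    with \<open>isCont d x\<close> have "d x = 0"
      by (metis isCont_def LIM_unique)
    with d0 have "\<forall>\<^sub>F u in nhds x. d u = 0"
      by (simp add: eventually_nhds_conv_at)
    then obtain V where V: "open V" "x \<in> V" "\<And>u. u \<in> V \<Longrightarrow> d u = 0"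
      unfolding eventually_nhds by blast
    have "local_diffeo (U \<inter> V) f"
      using local_diffeo_subset[OF f] oU V(1) by blast
    then show "\<exists>U f. x \<in> U \<and> U \<subseteq> dom E \<and> local_diffeo U f \<and> f ` U \<subseteq> dom F \<and>
      (\<forall>u\<in>U. deriv f u * x_scale F (f u) = x_scale E u \<and> J0 E u = J0 F (f u) \<and> J1 E u = J1 F (f u))"
      using U V inv by (intro exI[of _ "U \<inter> V"] exI[of _ f]) (auto simp: d_def)
  qed
qed

end
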